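(* Let $r, s$ be nonzero integers with $r>0$ and $\gcd(r,s)=1$. For each $n \ge 2$, there are only finitely many $n$-tuples of positive integers $(q_1, \dots, q_n)$ satisfying the cyclic system of $n$ simultaneous congruences $$ r\left(\frac{\prod_{k=1}^n q_k}{q_i}\right) \equiv s \pmod{q_i}, \qquad 1 \le i \le n, $$ together with the side conditions (i) at least two of the $q_i$ satisfy $q_i \ge 2$, and (ii) $\gcd(q_1 q_2 \cdots q_n, s) = 1$. Moreover, each such solution satisfies $$ \max_i \{q_i\} \le \begin{cases} \max\{u_n(r) - s - 1,\ s^2\} & \text{if } s>0,\\ \max\{u_n(r) - s - 1,\ |s|\} & \text{if } s<0.\end{cases} $$ For fixed $r,s$, the upper bound $u_n(r)-s-1$ is attained for all $n$ having $u_n(r) > s^2$.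
   Context: The sequence $u_n(r)$ is defined by $u_1(r) = r+1$ and $u_{n+1}(r) = r\left(\prod_{i=1}^n u_i(r)\right) + 1$ for $n \ge 1$.
   Formalization: Attainment fails with (i),(ii) as written (r=1, s=2, n=3 breaks (ii); n=2, r=s=1 breaks (i)); proved: a solution of the congruences attains u_n(r)-s-1, with (i) unless n=2, r=s=1, and with (ii) if all u_i(r), i<n, are coprime to s. *)

theory Defs
  imports "HOL-Number_Theory.Cong" "HOL-Library.FuncSet"
begin

text \<open>
  One equation covers \<open>u\<^sub>1 = r + 1\<close> (empty product) and the recursion; the paper's two
  equations are the two lemmas below. The value at index 0 is meaningless and never used.
\<close>

fun u :: "int \<Rightarrow> nat \<Rightarrow> int" where
  "u r n = r * (\<Prod>i\<in>{1..<n}. u r i) + 1"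

declare u.simps [simp del]

lemma u_1: "u r 1 = r + 1"
  by (subst u.simps) simp

lemma u_rec:
  assumes "n \<ge> 1"
  shows "u r (n + 1) = r * (\<Prod>i=1..n. u r i) + 1"
proof -
  have "{1..<n + 1} = {1..n}" by auto
  then show ?thesis by (simp only: u.simps[of r "n + 1"])
qed

text \<open>
  An \<open>n\<close>-tuple is a function on \<open>{1..n}\<close>, extensional so that distinct functions are
  distinct tuples. The \<open>div\<close> is exact.
\<close>

definition cyclic_solution :: "int \<Rightarrow> int \<Rightarrow> nat \<Rightarrow> (nat \<Rightarrow> int) \<Rightarrow> bool" where
  "cyclic_solution r s n q \<longleftrightarrow>
     q \<in> {1..n} \<rightarrow>\<^sub>E {1..} \<and>
     (\<forall>i\<in>{1..n}. [r * ((\<Prod>k=1..n. q k) div q i) = s] (mod (q i)))"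

definition side_i :: "nat \<Rightarrow> (nat \<Rightarrow> int) \<Rightarrow> bool" where
  "side_i n q \<longleftrightarrow> card {i \<in> {1..n}. q i \<ge> 2} \<ge> 2"

definition side_ii :: "int \<Rightarrow> nat \<Rightarrow> (nat \<Rightarrow> int) \<Rightarrow> bool" where
  "side_ii s n q \<longleftrightarrow> gcd (\<Prod>k=1..n. q k) s = 1"

text \<open>
  Any tuple attaining \<open>u r n - s - 1\<close> violates side condition (ii) unless
  \<open>u r 1, \<dots>, u r (n - 1)\<close> are coprime to \<open>s\<close> (for example \<open>r = 1\<close>, \<open>s = 2\<close>, \<open>n = 3\<close>), and
  violates (i) when \<open>n = 2\<close> and \<open>r = s = 1\<close>. This is why, in the attainment claim, the side
  conditions are asserted only outside these cases.
\<close>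

lemma attained_imp_coprime:
  assumes "n \<ge> 2" and ii: "side_ii s n q"
    and m: "Max (q ` {1..n}) = u r n - s - 1" and j: "j \<in> {1..<n}"
  shows "coprime (u r j) s"
proof -
  have "Max (q ` {1..n}) \<in> q ` {1..n}"
    using \<open>n \<ge> 2\<close> by (intro Max_in) auto
  then obtain i where i: "i \<in> {1..n}" "q i = u r n - s - 1"
    using m by auto
  have "u r j dvd (\<Prod>k\<in>{1..<n}. u r k)"
    using j by (intro dvd_prodI) auto
  then have j_dvd: "u r j dvd u r n - 1"
    by (simp add: u.simps[of r n])
  have "q i dvd (\<Prod>k=1..n. q k)"
    using i by (intro dvd_prodI) auto
  then have cop: "coprime (q i) s"
    using ii unfolding side_ii_def by (meson coprime_divisors coprime_iff_gcd_eq_1 dvd_refl)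
  show ?thesis
  proof (rule coprimeI)
    fix d assume d: "d dvd u r j" "d dvd s"
    then have "d dvd (u r n - 1) - s"
      using j_dvd by (meson dvd_diff dvd_trans)
    moreover have "(u r n - 1) - s = q i"
      using i by simp
    ultimately have "d dvd q i"
      by simp
    then show "is_unit d"
      using cop d(2) by (meson coprime_common_divisor)
  qed
qed

lemma not_attained_2_1_1:
  assumes "side_i 2 q"
  shows "Max (q ` {1..2}) \<noteq> u 1 2 - 1 - 1"
proof
  assume m: "Max (q ` {1..2}) = u 1 2 - 1 - 1"
  have "u 1 2 - 1 - 1 = 1"
    using u_rec[of 1 1] u_1[of 1] by (simp add: numeral_2_eq_2)
  then have "q i \<le> 1" if "i \<in> {1..2}" for i
    using that m by (metis Max_ge finite_atLeastAtMost finite_imageI imageI)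
  then have "{i \<in> {1..2}. q i \<ge> 2} = {}"
    by force
  then show False
    using assms unfolding side_i_def by (metis card.empty not_numeral_le_zero)
qed

end

theory Submission
  imports Complex_Main Defs
begin

text \<open>
  By (ii) the \<open>q i\<close> are pairwise coprime, so the congruences combine to
  \<open>(\<Sum>i. r / q i) - s / (\<Prod>i. q i) = m\<close> with \<open>m\<close> an integer. Sort the solution as
  \<open>a 0 \<le> \<dots> \<le> a N\<close>, and let \<open>Q k\<close> and \<open>U k\<close> be the products of the first \<open>k\<close> terms of
  \<open>a\<close> and of \<open>u r 1, u r 2, \<dots>\<close>. The remainder \<open>d k = m - (\<Sum>i<k. r / a i)\<close> has \<open>Q k\<close> as a
  denominator, so it is at least \<open>1 / Q k\<close> once it is positive; for \<open>u\<close> it is exactly \<open>1 / U k\<close>.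
  If \<open>a N\<close> exceeds \<open>r * U N - s = u r (N + 1) - s - 1\<close> and \<open>\<bar>s\<bar>\<close>, then \<open>Q N > U N\<close>. Take the
  last \<open>k\<close> with \<open>Q k \<le> U k\<close>. From there on the partial products of the terms \<open>r / a i\<close>, closed
  off by \<open>d N\<close>, lie below those of the terms \<open>r / u r (i + 1)\<close>, closed off by \<open>1 / U N\<close>. A
  majorization argument carries this over to the sums, giving \<open>d k < 1 / U k \<le> 1 / Q k\<close>, a
  contradiction. The extremal solution is \<open>u r 1, \<dots>, u r (n - 1), u r n - s - 1\<close>.
\<close>

section \<open>A logarithmic majorization inequality\<close>

text \<open>
  Abel summation of \<open>y i * ln (x i / y i) \<le> x i - y i\<close>; the logarithmic partial sums
  are nonnegative and \<open>y\<close> is decreasing.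
\<close>

lemma abel_ln_prod_le_sum_diff:
  fixes x y :: "nat \<Rightarrow> real"
  assumes "k \<le> n"
    and pos: "\<And>i. i \<in> {k..n} \<Longrightarrow> 0 < x i" "\<And>i. i \<in> {k..n} \<Longrightarrow> 0 < y i"
    and dec: "\<And>i. i \<in> {k..<n} \<Longrightarrow> y (Suc i) \<le> y i"
    and le: "\<And>j. j \<in> {k..<n} \<Longrightarrow> (\<Prod>i=k..j. y i) \<le> (\<Prod>i=k..j. x i)"
  shows "y n * ln ((\<Prod>i=k..n. x i) / (\<Prod>i=k..n. y i)) \<le> (\<Sum>i=k..n. x i) - (\<Sum>i=k..n. y i)"
proof -
  define l where "l i = ln (x i / y i)" for i
  have l_sum: "(\<Sum>i=k..j. l i) = ln ((\<Prod>i=k..j. x i) / (\<Prod>i=k..j. y i))" if "j \<le> n" for j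
  proof -
    have "x i / y i \<noteq> 0" if "i \<in> {k..j}" for i
      using that pos(1)[of i] pos(2)[of i] \<open>j \<le> n\<close> by simp
    then show ?thesis
      unfolding l_def prod_dividef[symmetric] by (intro ln_prod[symmetric]) auto
  qed
  have prod_pos_y: "(\<Prod>i=k..j. y i) > 0" if "j \<le> n" for j
    using that pos(2) by (intro prod_pos) auto
  have abel: "y j * (\<Sum>i=k..j. l i) \<le> (\<Sum>i=k..j. y i * l i)" if "k \<le> j" "j \<le> n" for j
    using that
  proof (induction j rule: dec_induct)
    case base
    then show ?case by simp
  next
    case (step j)
    have "(\<Sum>i=k..j. l i) \<ge> 0"
      using l_sum[of j] le[of j] prod_pos_y[of j] step by simp
    then have "y (Suc j) * (\<Sum>i=k..j. l i) \<le> y j * (\<Sum>i=k..j. l i)"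
      using dec[of j] step by (intro mult_right_mono) auto
    then show ?case
      using step by (simp add: algebra_simps)
  qed
  have "y n * ln ((\<Prod>i=k..n. x i) / (\<Prod>i=k..n. y i)) = y n * (\<Sum>i=k..n. l i)"
    using l_sum[of n] by simp
  also have "\<dots> \<le> (\<Sum>i=k..n. y i * l i)"
    using abel \<open>k \<le> n\<close> by simp
  also have "\<dots> \<le> (\<Sum>i=k..n. x i - y i)"
  proof (rule sum_mono)
    fix i assume i: "i \<in> {k..n}"
    have "l i \<le> x i / y i - 1"
      unfolding l_def using pos i by (intro ln_le_minus_one) simp
    then have "y i * l i \<le> y i * (x i / y i - 1)"
      using pos(2)[OF i] by (intro mult_left_mono) auto
    then show "y i * l i \<le> x i - y i"
      using pos(2)[OF i] by (simp add: right_diff_distrib)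
  qed
  finally show ?thesis by (simp add: sum_subtractf)
qed

section \<open>The sequence \<open>u\<close> and partial sums of Egyptian fractions\<close>

lemma u_Suc: "u r (Suc k) = r * (\<Prod>i<k. u r (Suc i)) + 1"
proof -
  have "{1..<Suc k} = {Suc 0..k}" by auto
  then show ?thesis
    by (subst u.simps) (simp only: prod.atLeast1_atMost_eq)
qed

lemma u_ge_2:
  assumes "r > 0"
  shows "u r (Suc k) \<ge> 2"
proof (induction k rule: less_induct)
  case (less k)
  then have "(\<Prod>i<k. u r (Suc i)) \<ge> 1"
    by (intro prod_ge_1) (smt (verit) lessThan_iff)
  then have "r * (\<Prod>i<k. u r (Suc i)) \<ge> 1 * 1"
    using assms by (intro mult_mono) auto
  then show ?case by (subst u_Suc) simp
qed

lemma prod_u_pos: "r > 0 \<Longrightarrow> (\<Prod>i\<in>A. u r (Suc i)) > 0"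
  by (intro prod_pos) (smt (verit) u_ge_2)

text \<open>The sum telescopes: with \<open>U\<close> the product of the first \<open>k\<close>
  terms, \<open>u r (Suc k) = r * U + 1\<close>, so the next summand is
  \<open>1 / U - 1 / (U * u r (Suc k))\<close>.\<close>

lemma sum_r_div_u:
  assumes "r > 0"
  shows "(\<Sum>i<k. real_of_int r / real_of_int (u r (Suc i))) = 1 - 1 / real_of_int (\<Prod>i<k. u r (Suc i))"
proof (induction k)
  case 0
  then show ?case by simp
next
  case (Suc k)
  define U where "U = real_of_int (\<Prod>i<k. u r (Suc i))"
  have U: "U > 0" unfolding U_def using prod_u_pos[OF assms] by (simp only: of_int_0_less_iff)
  define v where "v = real_of_int (u r (Suc k))"
  have v: "v = real_of_int r * U + 1" unfolding v_def U_def by (subst u_Suc) simp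
  have "v > 0" unfolding v_def using u_ge_2[OF assms, of k] by simp
  have "real_of_int (\<Prod>i<Suc k. u r (Suc i)) = U * v" by (simp add: U_def v_def)
  moreover have "1 - 1 / U + real_of_int r / v = 1 - 1 / (U * v)"
  proof -
    have "real_of_int r / v = (v - 1) / (U * v)"
      using U by (simp add: v)
    then show ?thesis
      using U \<open>v > 0\<close> by (simp add: diff_divide_distrib)
  qed
  ultimately show ?case
    by (simp only: sum.lessThan_Suc Suc U_def[symmetric] v_def[symmetric])
qed

text \<open>The product is a common denominator of the partial sum. Hence a positive remainder
  cannot be smaller than the reciprocal of the product.\<close>

lemma prod_times_egyptian_in_Ints:
  fixes a :: "nat \<Rightarrow> int" and r m :: int
  assumes "\<And>i. i < k \<Longrightarrow> a i \<noteq> 0"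
  shows "real_of_int (\<Prod>i<k. a i) * (m - (\<Sum>i<k. r / a i)) \<in> \<int>"
  using assms
proof (induction k)
  case 0
  then show ?case by simp
next
  case (Suc k)
  let ?Q = "real_of_int (\<Prod>i<k. a i)" and ?S = "\<Sum>i<k. real_of_int r / real_of_int (a i)"
  have "real_of_int (\<Prod>i<Suc k. a i) * (m - (\<Sum>i<Suc k. r / a i)) = a k * (?Q * (m - ?S)) - r * ?Q"
    using Suc.prems[of k] by (simp add: field_simps)
  moreover have "?Q * (m - ?S) \<in> \<int>" using Suc by simp
  ultimately show ?case by (simp only: Ints_diff Ints_mult Ints_of_int)
qed

section \<open>The bound for a sorted solution\<close>

text \<open>
  As a function of \<open>Q\<close>, \<open>r / Q - s / Q\<^sup>2\<close> decreases beyond \<open>2 * s / r\<close>; when \<open>U\<close> lies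
  below that point, its maximum \<open>r\<^sup>2 / (4 * s)\<close> is small enough.
\<close>

lemma last_term_estimate:
  fixes r s Q U t :: real
  assumes "r > 0" "0 < U" "U < Q" "r * U - s < t" "\<bar>s\<bar> < t"
  shows "(r * Q - s) * U\<^sup>2 < Q\<^sup>2 * t"
proof (cases "2 * s \<le> r * U")
  case True
  have *: "(r * U - s) * Q\<^sup>2 - (r * Q - s) * U\<^sup>2 = (Q - U) * (r * U * Q - s * (Q + U))"
    by (simp add: power2_eq_square algebra_simps)
  have "s * (Q + U) \<le> r * U * Q"
  proof (cases "s \<ge> 0")
    case True
    then have "s * (Q + U) \<le> s * (2 * Q)" using assms by (intro mult_left_mono) auto
    also have "\<dots> = (2 * s) * Q" by simp
    also have "\<dots> \<le> r * U * Q" using \<open>2 * s \<le> r * U\<close> assms by (intro mult_right_mono) auto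
    finally show ?thesis .
  next
    case False
    then have "s * (Q + U) \<le> 0" using assms by (intro mult_nonpos_nonneg) auto
    also have "0 \<le> r * U * Q" using assms by simp
    finally show ?thesis .
  qed
  then have "0 \<le> (Q - U) * (r * U * Q - s * (Q + U))" using assms by simp
  then have "(r * Q - s) * U\<^sup>2 \<le> (r * U - s) * Q\<^sup>2" using * by simp
  also have "\<dots> < t * Q\<^sup>2" using assms by (intro mult_strict_right_mono) auto
  finally show ?thesis by (simp add: mult.commute)
next
  case False
  then have s: "s > 0" using assms by (smt (verit) mult_pos_pos)
  have "0 \<le> (r * Q - 2 * s)\<^sup>2" by simp
  then have "4 * s * (r * Q - s) \<le> (r * Q)\<^sup>2" by (simp add: power2_eq_square algebra_simps)
  then have "4 * s * (r * Q - s) * U\<^sup>2 \<le> (r * Q)\<^sup>2 * U\<^sup>2" by (intro mult_right_mono) auto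
  also have "\<dots> = Q\<^sup>2 * (r * U)\<^sup>2" by (simp add: power2_eq_square)
  also have "\<dots> < Q\<^sup>2 * (2 * s)\<^sup>2"
    using False assms by (intro mult_strict_left_mono power_strict_mono) auto
  also have "\<dots> = 4 * s * (Q\<^sup>2 * s)" by (simp add: power2_eq_square)
  also have "\<dots> \<le> 4 * s * (Q\<^sup>2 * t)" using assms s by (intro mult_left_mono) auto
  finally show ?thesis using s by (simp add: mult.assoc)
qed

text \<open>By \<open>eq\<close>, the remainder \<open>m - (\<Sum>i<N. r / a i)\<close> has
  numerator \<open>r * (\<Prod>i<N. a i) - s\<close> over the full product; \<open>ne\<close> says
  that it does not vanish.\<close>

lemma sorted_egyptian_bound:
  fixes a :: "nat \<Rightarrow> int" and r s m :: int
  assumes r: "r > 0"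
    and a1: "\<And>i. i \<le> N \<Longrightarrow> a i \<ge> 1"
    and mono: "\<And>i. i < N \<Longrightarrow> a i \<le> a (Suc i)"
    and eq: "(\<Sum>i\<le>N. real_of_int r / a i) - s / real_of_int (\<Prod>i\<le>N. a i) = m"
    and ne: "r * (\<Prod>i<N. a i) \<noteq> s"
  shows "a N \<le> max (u r (Suc N) - s - 1) \<bar>s\<bar>"
proof (rule ccontr)
  define Q where "Q k = (\<Prod>i<k. a i)" for k
  define U where "U k = (\<Prod>i<k. u r (Suc i))" for k
  define d where "d k = real_of_int m - (\<Sum>i<k. real_of_int r / a i)" for k
  assume "\<not> ?thesis"
  then have big: "r * U N - s < a N" "\<bar>s\<bar> < a N"
    by (auto simp: u_Suc[of r N] U_def)
  have nz: "a i \<noteq> 0" if "i \<le> N" for i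
    using a1[OF that] by simp
  have Qpos: "Q k > 0" if "k \<le> Suc N" for k
    unfolding Q_def using that by (intro prod_pos) (auto intro!: less_le_trans[OF zero_less_one a1])
  have Upos: "U k > 0" for k
    unfolding U_def by (rule prod_u_pos[OF r])
  have aN: "a N > 0" using a1[of N] by simp
  have dN: "d N = (r * Q N - s) / (Q N * real_of_int (a N))"
  proof -
    have "(\<Prod>i\<le>N. a i) = Q N * a N"
      by (simp add: Q_def lessThan_Suc_atMost[symmetric])
    moreover have "(\<Sum>i\<le>N. real_of_int r / a i) = (real_of_int m - d N) + r / a N"
      by (simp add: d_def lessThan_Suc_atMost[symmetric])
    ultimately have "d N = r / a N - s / (Q N * a N)" using eq by simp
    then show ?thesis using aN Qpos[of N] by (simp add: diff_divide_distrib)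
  qed
  have Qd: "real_of_int (Q k) * d k \<in> \<int>" if "k \<le> N" for k
    unfolding Q_def d_def using that by (intro prod_times_egyptian_in_Ints) (simp add: nz)
  obtain z :: int where z: "real_of_int (Q N) * d N = z"
    using Qd[of N] by (auto elim: Ints_cases)
  have "real_of_int (Q N) * d N * a N = r * Q N - s"
    unfolding dN using aN Qpos[of N] by simp
  then have "real_of_int (z * a N) = real_of_int (r * Q N - s)"
    using z by simp
  then have za: "z * a N = r * Q N - s" by (simp only: of_int_eq_iff)
  have "z \<noteq> 0" using za ne unfolding Q_def by auto
  \<comment> \<open>If \<open>z \<le> -1\<close>, then \<open>za\<close> gives
    \<open>a N \<le> s - r * Q N < s\<close>, against \<open>\<bar>s\<bar> < a N\<close>.\<close>
  have "z > 0"
  proof (rule ccontr)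
    assume "\<not> z > 0"
    then have "- z \<ge> 1" using \<open>z \<noteq> 0\<close> by simp
    then have "1 * a N \<le> - z * a N" using aN by (intro mult_right_mono) auto
    moreover have "r * Q N > 0" using r Qpos[of N] by simp
    ultimately have "a N < s" using za by simp
    then show False using big by simp
  qed
  \<comment> \<open>Now \<open>r * U N - s < a N \<le> r * Q N - s\<close>.\<close>
  then have "1 * a N \<le> z * a N" using aN by (intro mult_right_mono) auto
  then have "r * U N < r * Q N" using za big by simp
  then have UQ: "U N < Q N" using r by simp
  have dN_pos: "d N > 0"
    using z \<open>z > 0\<close> Qpos[of N] by (metis le_SucI of_int_0_less_iff order_refl zero_less_mult_pos)
  \<comment> \<open>For \<open>s > 0\<close> this will compare the full products, closing terms
    included.\<close>
  have last: "d N * (real_of_int (U N))\<^sup>2 < Q N"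
  proof -
    have "(real_of_int r * Q N - s) * (real_of_int (U N))\<^sup>2 < (real_of_int (Q N))\<^sup>2 * a N"
    proof (rule last_term_estimate)
      show "real_of_int r * U N - s < a N"
        using big(1) by (metis of_int_diff of_int_less_iff of_int_mult)
    qed (use r Upos[of N] UQ big in auto)
    then show ?thesis
      unfolding dN times_divide_eq_left using Qpos[of N] aN
      by (subst pos_divide_less_eq) (auto simp: power2_eq_square mult.assoc)
  qed
  \<comment> \<open>Index 0 qualifies because both products are empty, and \<open>N\<close> is
    excluded by \<open>UQ\<close>; so the maximum exists and lies below \<open>N\<close>.\<close>
  obtain k where k: "k < N" "Q k \<le> U k" and gt: "\<And>j. k < j \<Longrightarrow> j \<le> N \<Longrightarrow> U j < Q j"
  proof -
    define k where "k = Max {j. j \<le> N \<and> Q j \<le> U j}"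
    have fin: "finite {j. j \<le> N \<and> Q j \<le> U j}" by simp
    have "0 \<in> {j. j \<le> N \<and> Q j \<le> U j}" by (simp add: Q_def U_def)
    then have kin: "k \<in> {j. j \<le> N \<and> Q j \<le> U j}"
      unfolding k_def using Max_in[OF fin] by blast
    then have "k < N" using UQ by (cases "k = N") auto
    moreover have "U j < Q j" if "k < j" "j \<le> N" for j
      using Max_ge[OF fin, of j] that unfolding k_def[symmetric] by force
    ultimately show ?thesis using that kin by blast
  qed
  have Q_split: "Q (Suc j) = Q k * (\<Prod>i=k..j. a i)"
    and U_split: "U (Suc j) = U k * (\<Prod>i=k..j. u r (Suc i))" if "k \<le> j" for j
    using that unfolding Q_def U_def lessThan_atLeast0 atLeastLessThanSuc_atLeastAtMost[symmetric]
    by (auto simp: prod.atLeastLessThan_concat)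
  have a_pos: "(\<Prod>i=k..j. a i) > 0" if "j \<le> N" for j
    using that by (intro prod_pos) (auto intro!: less_le_trans[OF zero_less_one a1])
  have u_pos: "(\<Prod>i=k..j. u r (Suc i)) > 0" for j
    using prod_u_pos[OF r] .
  \<comment> \<open>Past \<open>k\<close> the products of \<open>a\<close> have overtaken those of
    \<open>u\<close>, although \<open>Q k \<le> U k\<close>; so the blocks starting at
    \<open>k\<close> must already compare.\<close>
  have prod_le: "(\<Prod>i=k..j. u r (Suc i)) \<le> (\<Prod>i=k..j. a i)" if "j \<in> {k..<N}" for j
  proof -
    have "U k * (\<Prod>i=k..j. u r (Suc i)) \<le> Q k * (\<Prod>i=k..j. a i)"
      using gt[of "Suc j"] Q_split[of j] U_split[of j] that by simp
    also have "\<dots> \<le> U k * (\<Prod>i=k..j. a i)"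
      using k(2) a_pos[of j] that by (intro mult_right_mono) auto
    finally show ?thesis using Upos[of k] by simp
  qed
  \<comment> \<open>Index \<open>N\<close> holds the closing terms in place of
    \<open>r / a N\<close> and \<open>r / u r (Suc N)\<close>. With them the sums from
    \<open>k\<close> to \<open>N\<close> are exactly \<open>d k\<close> and
    \<open>1 / U k\<close>.\<close>
  define y where "y i = (if i < N then r / a i else d N)" for i
  define x where "x i = (if i < N then r / u r (Suc i) else 1 / U N)" for i
  have prod_y: "(\<Prod>i=k..j. y i) = real_of_int r ^ (Suc j - k) / (\<Prod>i=k..j. a i)" if "j < N" for j
  proof -
    have "(\<Prod>i=k..j. y i) = (\<Prod>i=k..j. r / a i)"
      using that by (intro prod.cong) (auto simp: y_def)
    then show ?thesis by (simp add: prod_dividef)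
  qed
  have prod_x: "(\<Prod>i=k..j. x i) = real_of_int r ^ (Suc j - k) / (\<Prod>i=k..j. u r (Suc i))" if "j < N" for j
  proof -
    have "(\<Prod>i=k..j. x i) = (\<Prod>i=k..j. r / u r (Suc i))"
      using that by (intro prod.cong) (auto simp: x_def)
    then show ?thesis by (simp add: prod_dividef)
  qed
  obtain M where M: "N = Suc M" "k \<le> M" using k(1) by (cases N) auto
  have x_pos: "0 < x i" if "i \<in> {k..N}" for i
    using r Upos[of N] u_ge_2[OF r, of i] by (auto simp: x_def)
  have y_pos: "0 < y i" if "i \<in> {k..N}" for i
    using r a1[of i] dN_pos that by (auto simp: y_def)
  have prods_le: "(\<Prod>i=k..j. y i) \<le> (\<Prod>i=k..j. x i)" if "j \<in> {k..<N}" for j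
  proof -
    have "j < N" using that by simp
    have "real_of_int (\<Prod>i=k..j. u r (Suc i)) \<le> real_of_int (\<Prod>i=k..j. a i)"
      using prod_le[OF that] by (simp only: of_int_le_iff)
    moreover have "real_of_int (\<Prod>i=k..j. u r (Suc i)) > 0"
      using u_pos[of j] by (simp only: of_int_0_less_iff)
    ultimately show ?thesis
      unfolding prod_y[OF \<open>j < N\<close>] prod_x[OF \<open>j < N\<close>] using r
      by (intro divide_left_mono mult_pos_pos) auto
  qed
  have prod_y_pos: "(\<Prod>i=k..j. y i) > 0" if "j \<le> N" for j
    using that y_pos by (intro prod_pos) auto
  have y_dec: "y (Suc i) \<le> y i" if "Suc i < N" for i
    using that r a1[of i] a1[of "Suc i"] mono[of i] by (auto simp: y_def intro!: divide_left_mono)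
  have "(\<Sum>i=k..N. y i) < (\<Sum>i=k..N. x i)"
  proof (cases "s > 0") \<comment> \<open>for \<open>s < 0\<close> the closing term \<open>d N\<close> may exceed \<open>y M\<close>\<close>
    case True
    \<comment> \<open>After cancelling the common power of \<open>r\<close>, this is
      \<open>last\<close> with \<open>Q N = Q k * A\<close>, \<open>U N = U k * V\<close> and
      \<open>Q k \<le> U k\<close>.\<close>
    have prods_less: "(\<Prod>i=k..N. y i) < (\<Prod>i=k..N. x i)"
    proof -
      define A V where "A = real_of_int (\<Prod>i=k..M. a i)"
        and "V = real_of_int (\<Prod>i=k..M. u r (Suc i))"
      have AV: "A > 0" "V > 0"
        unfolding A_def V_def using a_pos[of M] u_pos[of M] M by (simp_all only: of_int_0_less_iff)
      have QA: "real_of_int (Q N) = Q k * A" and UV: "real_of_int (U N) = U k * V"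
        unfolding A_def V_def using Q_split[of M] U_split[of M] M by simp_all
      have Uk: "real_of_int (U k) > 0" "real_of_int (U N) > 0" using Upos by simp_all
      have "U k * (d N * V * U N) = d N * (real_of_int (U N))\<^sup>2"
        by (simp add: UV power2_eq_square)
      also have "\<dots> < Q N" by (rule last)
      also have "\<dots> \<le> U k * A"
        unfolding QA using k(2) AV by (intro mult_right_mono) auto
      finally have "d N * V * U N < A" using Uk by simp
      then have "d N / A < 1 / (V * U N)"
        using AV Uk by (simp add: field_simps)
      then have "real_of_int r ^ (Suc M - k) * (d N / A) < real_of_int r ^ (Suc M - k) * (1 / (V * U N))"
        using r by (intro mult_strict_left_mono) auto
      moreover have "(\<Prod>i=k..N. y i) = real_of_int r ^ (Suc M - k) * (d N / A)"
        using prod_y[of M] M by (simp add: A_def y_def)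
      moreover have "(\<Prod>i=k..N. x i) = real_of_int r ^ (Suc M - k) * (1 / (V * U N))"
        using prod_x[of M] M by (simp add: V_def x_def)
      ultimately show ?thesis by simp
    qed
    \<comment> \<open>For \<open>s > 0\<close> the closing term is at most \<open>r / a N\<close>,
      so \<open>y\<close> stays decreasing up to index \<open>N\<close> and the majorization covers
      the whole range.\<close>
    have "y (Suc M) \<le> y M"
    proof -
      have "d N \<le> r / a N"
        unfolding dN using Qpos[of N] aN True by (simp add: field_simps)
      also have "\<dots> \<le> r / a M"
        using r a1[of M] aN mono[of M] M by (intro divide_left_mono) auto
      finally show ?thesis using M by (simp add: y_def)
    qed
    then have dec: "y (Suc i) \<le> y i" if "i \<in> {k..<N}" for i
      using y_dec[of i] that M by (cases "i = M") auto
    have "0 < y N * ln ((\<Prod>i=k..N. x i) / (\<Prod>i=k..N. y i))"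
      using prods_less prod_y_pos[of N] y_pos[of N] k(1) by (intro mult_pos_pos ln_gt_zero) auto
    also have "\<dots> \<le> (\<Sum>i=k..N. x i) - (\<Sum>i=k..N. y i)"
      using k(1) x_pos y_pos dec prods_le by (intro abel_ln_prod_le_sum_diff) auto
    finally show ?thesis by simp
  next
    case False
    \<comment> \<open>Here the majorization stops at \<open>M\<close>, and the closing terms are
      compared directly.\<close>
    have "0 \<le> y M * ln ((\<Prod>i=k..M. x i) / (\<Prod>i=k..M. y i))"
      using prods_le[of M] prod_y_pos[of M] y_pos[of M] M by (intro mult_nonneg_nonneg ln_ge_zero) auto
    also have "\<dots> \<le> (\<Sum>i=k..M. x i) - (\<Sum>i=k..M. y i)"
      using M x_pos y_pos y_dec prods_le by (intro abel_ln_prod_le_sum_diff) auto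
    finally have "(\<Sum>i=k..M. y i) \<le> (\<Sum>i=k..M. x i)" by simp
    \<comment> \<open>For \<open>s \<le> 0\<close> the function \<open>r - s / Q\<close> is
      nonincreasing in \<open>Q\<close>, so
      \<open>d N * a N = r - s / Q N \<le> r - s / U N < a N / U N\<close>.\<close>
    moreover have "d N < 1 / U N"
    proof -
      have "- s * U N \<le> - s * Q N" using False UQ by (intro mult_left_mono) auto
      then have "(r * Q N - s) * U N \<le> Q N * (r * U N - s)" by (simp add: algebra_simps)
      also have "\<dots> < Q N * a N" using big(1) Qpos[of N] by simp
      finally have "real_of_int ((r * Q N - s) * U N) < real_of_int (Q N * a N)"
        by (simp only: of_int_less_iff)
      then show ?thesis
        unfolding dN using Upos[of N] Qpos[of N] aN by (simp add: divide_less_eq less_divide_eq)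
    qed
    ultimately show ?thesis using M by (simp add: x_def y_def)
  qed
  moreover have "(\<Sum>i=k..N. y i) = d k"
  proof -
    have "(\<Sum>i=k..N. y i) = (\<Sum>i=k..<N. r / a i) + d N"
      using M by (simp add: y_def atLeastLessThanSuc_atLeastAtMost)
    moreover have "(\<Sum>i<N. real_of_int r / a i) = (\<Sum>i<k. r / a i) + (\<Sum>i=k..<N. r / a i)"
      using k(1) by (simp add: lessThan_atLeast0 sum.atLeastLessThan_concat)
    ultimately show ?thesis by (simp add: d_def)
  qed
  moreover have "(\<Sum>i=k..N. x i) = 1 / U k"
  proof -
    have "(\<Sum>i=k..N. x i) = (\<Sum>i=k..<N. r / u r (Suc i)) + 1 / U N"
      using M by (simp add: x_def atLeastLessThanSuc_atLeastAtMost)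
    moreover have "(\<Sum>i<N. real_of_int r / u r (Suc i)) = (\<Sum>i<k. r / u r (Suc i)) + (\<Sum>i=k..<N. r / u r (Suc i))"
      using k(1) by (simp add: lessThan_atLeast0 sum.atLeastLessThan_concat)
    ultimately show ?thesis
      unfolding sum_r_div_u[OF r] U_def by simp
  qed
  \<comment> \<open>\<open>Q k * d k\<close> is an integer, positive since
    \<open>d k \<ge> d N > 0\<close>; hence it is at least 1, and
    \<open>Q k \<le> U k\<close>.\<close>
  moreover have "d k \<ge> 1 / U k"
  proof -
    have "(\<Sum>i=k..<N. real_of_int r / a i) \<ge> 0"
      using r a1 by (intro sum_nonneg) (simp add: order.trans[OF zero_le_one])
    moreover have "(\<Sum>i<N. real_of_int r / a i) = (\<Sum>i<k. r / a i) + (\<Sum>i=k..<N. r / a i)"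
      using k(1) by (simp add: lessThan_atLeast0 sum.atLeastLessThan_concat)
    ultimately have "d k > 0" using dN_pos by (simp add: d_def)
    obtain w :: int where w: "real_of_int (Q k) * d k = w"
      using Qd[of k] k(1) by (auto elim: Ints_cases)
    have "w > 0"
      using w \<open>d k > 0\<close> Qpos[of k] k(1) by (metis less_imp_le le_SucI of_int_0_less_iff mult_pos_pos)
    then have "real_of_int (Q k) * d k \<ge> 1" using w by simp
    also have "real_of_int (Q k) * d k \<le> U k * d k"
      using k(2) \<open>d k > 0\<close> by (intro mult_right_mono) auto
    finally show ?thesis using Upos[of k] by (simp add: field_simps)
  qed
  ultimately show False by simp
qed

section \<open>From the congruences to the Egyptian fraction equation\<close>

lemma cyclic_solution_pos:
  assumes "cyclic_solution r s n q" "i \<in> {1..n}"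
  shows "q i \<ge> 1"
  using assms unfolding cyclic_solution_def by (auto dest!: PiE_mem)

lemma dvd_prod_div:
  fixes q :: "'a \<Rightarrow> int"
  assumes "finite A" "i \<in> A" "j \<in> A" "i \<noteq> j" "q j \<noteq> 0"
  shows "q i dvd (\<Prod>k\<in>A. q k) div q j"
proof -
  have "(\<Prod>k\<in>A. q k) div q j = (\<Prod>k\<in>A - {j}. q k)"
    using assms by (subst prod.remove[of A j]) auto
  then show ?thesis using assms by (auto intro: dvd_prodI)
qed

text \<open>A common divisor of \<open>q i\<close> and \<open>q j\<close> divides both the modulus
  \<open>q j\<close> and the cofactor of \<open>q j\<close>, which contains \<open>q i\<close>. The
  congruence then makes it divide \<open>s\<close>, and (ii) makes it a unit.\<close>

lemma cyclic_solution_coprime: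
  assumes sol: "cyclic_solution r s n q" and ii: "side_ii s n q"
    and ij: "i \<in> {1..n}" "j \<in> {1..n}" "i \<noteq> j"
  shows "coprime (q i) (q j)"
proof (rule coprimeI)
  fix d assume d: "d dvd q i" "d dvd q j"
  have "q j \<noteq> 0" using cyclic_solution_pos[OF sol ij(2)] by simp
  then have "d dvd r * ((\<Prod>k=1..n. q k) div q j)"
    using ij d(1) dvd_prod_div[of "{1..n}" i j q] by (meson dvd_mult dvd_trans finite_atLeastAtMost)
  moreover have "q j dvd r * ((\<Prod>k=1..n. q k) div q j) - s"
    using sol ij(2) by (auto simp: cyclic_solution_def cong_iff_dvd_diff)
  ultimately have "d dvd s"
    using d(2) dvd_diff_right_iff dvd_trans by blast
  moreover have "q i dvd (\<Prod>k=1..n. q k)"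
    using ij by (intro dvd_prodI) auto
  ultimately have "d dvd gcd (\<Prod>k=1..n. q k) s"
    using d(1) by (meson dvd_trans gcd_greatest)
  then show "is_unit d" using ii unfolding side_ii_def by (simp only:)
qed

text \<open>Modulo \<open>q i\<close> every cofactor except that of \<open>q i\<close> vanishes, so
  the sum of all \<open>r * (P div q j)\<close> is congruent to \<open>s\<close> modulo each
  \<open>q i\<close>. By pairwise coprimality this holds modulo the product \<open>P\<close>;
  dividing by \<open>P\<close> gives the equation.\<close>

lemma cyclic_solution_egyptian:
  assumes sol: "cyclic_solution r s n q" and ii: "side_ii s n q"
  obtains m :: int
    where "(\<Sum>i=1..n. real_of_int r / q i) - s / real_of_int (\<Prod>i=1..n. q i) = m"
proof -
  define P where "P = (\<Prod>i=1..n. q i)"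
  have pos: "q i > 0" if "i \<in> {1..n}" for i
    using cyclic_solution_pos[OF sol that] by simp
  then have "P > 0" unfolding P_def by (intro prod_pos) auto
  have "[(\<Sum>j=1..n. r * (P div q j)) = s] (mod q i)" if i: "i \<in> {1..n}" for i
  proof -
    have "(\<Sum>j=1..n. r * (P div q j)) = r * (P div q i) + (\<Sum>j\<in>{1..n} - {i}. r * (P div q j))"
      using i by (subst sum.remove[of _ i]) auto
    then have "(\<Sum>j=1..n. r * (P div q j)) - s = (r * (P div q i) - s) + (\<Sum>j\<in>{1..n} - {i}. r * (P div q j))"
      by (simp only: add_diff_eq diff_add_eq)
    moreover have "q i dvd (\<Sum>j\<in>{1..n} - {i}. r * (P div q j))"
      unfolding P_def using i pos
      by (intro dvd_sum dvd_mult dvd_prod_div) (auto simp: order_less_imp_not_eq2)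
    moreover have "q i dvd r * (P div q i) - s"
      using sol i by (auto simp: cyclic_solution_def P_def cong_iff_dvd_diff)
    ultimately have "q i dvd (\<Sum>j=1..n. r * (P div q j)) - s"
      by (simp only: dvd_add)
    then show ?thesis by (simp add: cong_iff_dvd_diff)
  qed
  then have "[(\<Sum>j=1..n. r * (P div q j)) = s] (mod P)"
    unfolding P_def using cyclic_solution_coprime[OF sol ii]
    by (intro cong_cong_prod_coprime) auto
  then obtain m where m: "(\<Sum>j=1..n. r * (P div q j)) - s = P * m"
    by (auto simp: cong_iff_dvd_diff)
  have "real_of_int r / q i = real_of_int (r * (P div q i)) / P" if i: "i \<in> {1..n}" for i
  proof -
    have "q i dvd P" unfolding P_def using i by (intro dvd_prodI) auto
    then obtain c where "P = q i * c" by blast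
    then show ?thesis using pos[OF i] \<open>P > 0\<close> by (cases "c = 0") auto
  qed
  then have "(\<Sum>i=1..n. real_of_int r / q i) = real_of_int (\<Sum>i=1..n. r * (P div q i)) / P"
    by (simp add: sum_divide_distrib)
  then have "(\<Sum>i=1..n. real_of_int r / q i) - s / P = real_of_int ((\<Sum>i=1..n. r * (P div q i)) - s) / P"
    by (simp add: diff_divide_distrib)
  also have "\<dots> = m" unfolding m using \<open>P > 0\<close> by simp
  finally show ?thesis using that unfolding P_def by blast
qed

lemma ex_sorting_bij:
  fixes q :: "nat \<Rightarrow> 'a :: linorder"
  obtains p where "bij_betw p {..<n} {1..n}" "\<And>i j. i \<le> j \<Longrightarrow> j < n \<Longrightarrow> q (p i) \<le> q (p j)"
proof -
  define xs where "xs = sort_key q [1..<Suc n]"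
  have "distinct xs" "length xs = n" "set xs = {1..n}"
    unfolding xs_def by (auto simp del: upt_Suc)
  then have "bij_betw ((!) xs) {..<n} {1..n}"
    by (intro bij_betw_nth) auto
  moreover have "sorted (map q xs)" unfolding xs_def by (rule sorted_sort_key)
  then have "q (xs ! i) \<le> q (xs ! j)" if "i \<le> j" "j < n" for i j
    using sorted_nth_mono[of "map q xs" i j] that \<open>length xs = n\<close> by simp
  ultimately show ?thesis using that by blast
qed

lemma cyclic_solution_le:
  assumes "r > 0"
    and sol: "cyclic_solution r s n q" and i: "side_i n q" and ii: "side_ii s n q"
    and j: "j \<in> {1..n}"
  shows "q j \<le> max (u r n - s - 1) \<bar>s\<bar>"
proof -
  obtain N where N: "n = Suc N" using j by (cases n) auto
  obtain p where p: "bij_betw p {..<n} {1..n}"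
    and mono: "\<And>i j. i \<le> j \<Longrightarrow> j < n \<Longrightarrow> q (p i) \<le> q (p j)"
    using ex_sorting_bij[of n q] by blast
  have p_in: "p k \<in> {1..n}" if "k < n" for k
    using p that by (auto dest: bij_betwE)
  define a where "a k = q (p k)" for k
  have a1: "a k \<ge> 1" if "k < n" for k
    unfolding a_def using cyclic_solution_pos[OF sol p_in[OF that]] .
  obtain m :: int where m: "(\<Sum>i=1..n. real_of_int r / q i) - s / real_of_int (\<Prod>i=1..n. q i) = m"
    using cyclic_solution_egyptian[OF sol ii] .
  have prod_a: "(\<Prod>k<n. a k) = (\<Prod>k=1..n. q k)"
    unfolding a_def by (rule prod.reindex_bij_betw[OF p])
  \<comment> \<open>This is where (i) enters. In case of equality the product of all entries but the
    largest divides \<open>s\<close>, so (ii) makes it a unit, and at most one entry exceeds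
    1.\<close>
  have ne: "r * (\<Prod>k<N. a k) \<noteq> s"
  proof
    assume s: "r * (\<Prod>k<N. a k) = s"
    have "(\<Prod>k<N. a k) dvd gcd (\<Prod>k<n. a k) s"
      using s by (auto simp: N)
    then have Q1: "is_unit (\<Prod>k<N. a k)"
      using ii unfolding prod_a side_ii_def by (simp only:)
    have "a k = 1" if "k < N" for k
    proof -
      have "a k dvd (\<Prod>k<N. a k)" using that by (intro dvd_prodI) auto
      then show ?thesis using Q1 a1[of k] that N by (metis dvd_trans zdvd1_eq abs_of_pos less_SucI zero_less_one less_le_trans)
    qed
    then have "k = N" if "k < n" "q (p k) \<ge> 2" for k
      using that unfolding a_def N by (metis less_antisym one_less_numeral_iff semiring_norm(76) leD)
    then have "{i \<in> {1..n}. q i \<ge> 2} \<subseteq> {p N}"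
      using bij_betw_imp_surj_on[OF p] by (force simp del: atLeastAtMost_iff)
    then have "card {i \<in> {1..n}. q i \<ge> 2} \<le> 1"
      using card_mono[of "{p N}"] by simp
    then show False using i by (simp add: side_i_def)
  qed
  have "a N \<le> max (u r (Suc N) - s - 1) \<bar>s\<bar>"
  proof (rule sorted_egyptian_bound[OF \<open>r > 0\<close>, where m = m])
    show "(\<Sum>i\<le>N. real_of_int r / a i) - s / real_of_int (\<Prod>i\<le>N. a i) = m"
      using m sum.reindex_bij_betw[OF p, of "\<lambda>i. real_of_int r / q i"] prod_a
      by (simp add: a_def N lessThan_Suc_atMost)
  qed (use a1 mono ne in \<open>auto simp: a_def N\<close>)
  moreover obtain k where "k < n" "j = p k"
    using bij_betw_imp_surj_on[OF p] j by (metis imageE lessThan_iff)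
  then have "q j \<le> a N" using mono[of k N] by (simp add: a_def N)
  ultimately show ?thesis by (simp add: N)
qed

section \<open>The extremal solution\<close>

lemma u_cong_1:
  assumes "1 \<le> i" "i < j"
  shows "[u r j = 1] (mod u r i)"
proof -
  have "u r i dvd (\<Prod>k\<in>{1..<j}. u r k)" using assms by (intro dvd_prodI) auto
  then show ?thesis by (subst u.simps) (simp add: cong_iff_dvd_diff)
qed

text \<open>The terms before \<open>i\<close>, multiplied by \<open>r\<close>, give
  \<open>u r i - 1\<close>, and every later term is 1 modulo \<open>u r i\<close>.\<close>

lemma prod_u_cong:
  assumes "i \<in> {1..<n}"
  shows "[r * (\<Prod>k\<in>{1..<n} - {i}. u r k) = - 1] (mod u r i)"
proof -
  have "{1..<n} - {i} = {1..<i} \<union> {i<..<n}" "{1..<i} \<inter> {i<..<n} = {}" using assms by auto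
  then have "(\<Prod>k\<in>{1..<n} - {i}. u r k) = (\<Prod>k\<in>{1..<i}. u r k) * (\<Prod>k\<in>{i<..<n}. u r k)"
    by (simp only: prod.union_disjoint finite_atLeastLessThan finite_greaterThanLessThan)
  then have "r * (\<Prod>k\<in>{1..<n} - {i}. u r k) = (u r i - 1) * (\<Prod>k\<in>{i<..<n}. u r k)"
    by (simp add: u.simps[of r i] mult.assoc)
  moreover have "[(\<Prod>k\<in>{i<..<n}. u r k) = (\<Prod>k\<in>{i<..<n}. 1)] (mod u r i)"
    using assms by (intro cong_prod u_cong_1) auto
  moreover have "[u r i - 1 = - 1] (mod u r i)" by (simp add: cong_iff_dvd_diff)
  ultimately show ?thesis using cong_mult by fastforce
qed

lemma u_eq_pred:
  assumes "n \<ge> 2"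
  shows "u r n = u r (n - 1) * (u r (n - 1) - 1) + 1"
proof -
  have "{1..<n} = insert (n - 1) {1..<n - 1}" using assms by auto
  then have "(\<Prod>k\<in>{1..<n}. u r k) = u r (n - 1) * (\<Prod>k\<in>{1..<n - 1}. u r k)"
    by simp
  moreover have "r * (\<Prod>k\<in>{1..<n - 1}. u r k) = u r (n - 1) - 1"
    using u.simps[of r "n - 1"] by linarith
  ultimately show ?thesis
    by (subst u.simps) (simp add: mult.left_commute)
qed

text \<open>Modulo \<open>u r i\<close> the last entry is \<open>-s\<close> and \<open>r\<close>
  times the product of the other terms of \<open>u\<close> is \<open>-1\<close>; modulo the last
  entry, \<open>r * (\<Prod>k\<in>{1..<n}. u r k)\<close> exceeds it by \<open>s\<close>. The case
  excluded by \<open>nt\<close> has last entry 1, which breaks (i).\<close>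

lemma u_attained:
  assumes r: "r > 0" and s: "s \<noteq> 0" "gcd r s = 1" and n: "n \<ge> 2" and big: "u r n > s\<^sup>2"
    and nt: "\<not> (n = 2 \<and> r = 1 \<and> s = 1)"
  obtains q where "cyclic_solution r s n q" "Max (q ` {1..n}) = u r n - s - 1" "side_i n q"
    "(\<forall>i\<in>{1..<n}. coprime (u r i) s) \<longrightarrow> side_ii s n q"
proof -
  define t where "t = u r n - s - 1"
  define q where "q = (\<lambda>i\<in>{1..n}. if i = n then t else u r i)"
  have q_less: "q i = u r i" if "i \<in> {1..<n}" for i using that by (auto simp: q_def)
  have q_n: "q n = t" using n by (simp add: q_def)
  have u2: "u r i \<ge> 2" if "i \<ge> 1" for i
    using u_ge_2[OF r, of "i - 1"] that by simp
  define b where "b = u r (n - 1)"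
  have b: "u r n = b * (b - 1) + 1" "b \<ge> 2"
    unfolding b_def using u_eq_pred[OF n] u2[of "n - 1"] n by auto
  \<comment> \<open>This makes \<open>t\<close> the maximum and at least 2. Since
    \<open>t = b * (b - 1) - s\<close>, it amounts to \<open>s \<le> b * (b - 2)\<close>.\<close>
  have b_le_t: "b \<le> t"
  proof (cases "b = 2")
    case True
    \<comment> \<open>For \<open>n > 2\<close>, \<open>b = w * (w - 1) + 1\<close> with
      \<open>w \<ge> 2\<close>, so \<open>b \<ge> 3\<close>.\<close>
    have "n = 2"
    proof (rule ccontr)
      assume "n \<noteq> 2"
      then have "b = u r (n - 2) * (u r (n - 2) - 1) + 1" "u r (n - 2) \<ge> 2"
        unfolding b_def using u_eq_pred[of "n - 1" r] u2[of "n - 2"] n by (auto simp: numeral_2_eq_2)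
      then show False using True by (simp add: zmult_eq_1_iff)
    qed
    then have "r = 1" using True u_1[of r] by (simp add: b_def)
    with nt \<open>n = 2\<close> have "s \<noteq> 1" by simp
    moreover have "s < 2"
    proof (rule ccontr)
      assume "\<not> s < 2"
      then have "2\<^sup>2 \<le> s\<^sup>2" by (intro power_mono) auto
      then show False using big b True by simp
    qed
    ultimately have "s < 0" using s by simp
    then show ?thesis using b True by (simp add: t_def)
  next
    case False
    then have "b \<ge> 3" using b(2) by simp
    have "s \<le> b * (b - 2)"
    proof (cases "s \<le> 3")
      case True
      have "3 * 1 \<le> b * (b - 2)" using \<open>b \<ge> 3\<close> by (intro mult_mono) auto
      then show ?thesis using True by simp
    next
      case False
      \<comment> \<open>\<open>big\<close> gives \<open>s\<^sup>2 \<le> b * (b - 1)\<close>, whereas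
        \<open>s \<ge> b\<close> would give \<open>b * (b - 1) \<le> s\<^sup>2 - s\<close>.\<close>
      have "s < b"
      proof (rule ccontr)
        assume "\<not> s < b"
        then have "b * (b - 1) \<le> s * (s - 1)" using b(2) by (intro mult_mono) auto
        then show False using big b False by (simp add: power2_eq_square algebra_simps)
      qed
      then have "s * 1 \<le> b * (b - 2)" using \<open>b \<ge> 3\<close> by (intro mult_mono) auto
      then show ?thesis by simp
    qed
    then show ?thesis using b(1) by (simp add: t_def algebra_simps)
  qed
  have u_mono: "u r i \<le> u r j" if "1 \<le> i" "i \<le> j" for i j
    using that(2,1)
  proof (induction j rule: dec_induct)
    case (step j)
    have "u r j * 1 \<le> u r j * (u r j - 1)" using u2[of j] step by (intro mult_left_mono) auto
    then show ?case using u_eq_pred[of "Suc j" r] step by simp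
  qed simp
  have q_ge: "q i \<ge> 2" if "i \<in> {1..n}" for i
    using that u2[of i] b_le_t b(2) by (auto simp: q_def)
  have q_le: "q i \<le> t" if "i \<in> {1..n}" for i
  proof (cases "i = n")
    case False
    then have "u r i \<le> b" unfolding b_def using that by (intro u_mono) auto
    then show ?thesis using False that b_le_t by (simp add: q_def)
  qed (simp add: q_n)
  have split: "{1..n} = insert n {1..<n}" using n by auto
  have prod_q: "(\<Prod>k=1..n. q k) = t * (\<Prod>k\<in>{1..<n}. u r k)"
  proof -
    have "(\<Prod>k\<in>{1..<n}. q k) = (\<Prod>k\<in>{1..<n}. u r k)"
      by (rule prod.cong[OF refl q_less])
    then show ?thesis unfolding split by (simp add: q_n)
  qed
  have t: "t = r * (\<Prod>k\<in>{1..<n}. u r k) - s"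
    unfolding t_def by (subst u.simps) simp
  show ?thesis
  proof (rule that)
    show "cyclic_solution r s n q"
      unfolding cyclic_solution_def
    proof (intro conjI ballI)
      show "q \<in> {1..n} \<rightarrow>\<^sub>E {1..}"
        using q_ge by (force simp: q_def)
      fix i assume i: "i \<in> {1..n}"
      show "[r * ((\<Prod>k=1..n. q k) div q i) = s] (mod q i)"
      proof (cases "i = n")
        case True
        then show ?thesis
          unfolding prod_q using q_n q_ge[OF i] t by (simp add: cong_iff_dvd_diff)
      next
        case False
        then have i': "i \<in> {1..<n}" using i by simp
        have "(\<Prod>k\<in>{1..<n}. u r k) = u r i * (\<Prod>k\<in>{1..<n} - {i}. u r k)"
          using i' by (intro prod.remove) auto
        then have "r * ((\<Prod>k=1..n. q k) div q i) = (r * (\<Prod>k\<in>{1..<n} - {i}. u r k)) * t"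
          unfolding prod_q using q_less[OF i'] q_ge[OF i] by simp
        moreover have "[(r * (\<Prod>k\<in>{1..<n} - {i}. u r k)) * t = - 1 * (- s)] (mod u r i)"
        proof (rule cong_mult[OF prod_u_cong[OF i']])
          show "[t = - s] (mod u r i)"
            using u_cong_1[of i n r] i' by (simp add: t_def cong_iff_dvd_diff)
        qed
        ultimately have "[r * ((\<Prod>k=1..n. q k) div q i) = - 1 * (- s)] (mod u r i)"
          by (simp only:)
        then show ?thesis using q_less[OF i'] by simp
      qed
    qed
    show "Max (q ` {1..n}) = u r n - s - 1"
      unfolding t_def[symmetric] using q_le q_n n
      by (intro Max_eqI) (auto intro!: image_eqI[of t q n])
    have "{i \<in> {1..n}. q i \<ge> 2} = {1..n}" using q_ge by auto
    then show "side_i n q" using n by (simp add: side_i_def)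
    show "(\<forall>i\<in>{1..<n}. coprime (u r i) s) \<longrightarrow> side_ii s n q"
    proof
      assume "\<forall>i\<in>{1..<n}. coprime (u r i) s"
      then have c: "coprime (\<Prod>k\<in>{1..<n}. u r k) s" by (intro prod_coprime_left) auto
      moreover have "coprime r s" using s(2) by (simp only: coprime_iff_gcd_eq_1)
      ultimately have "coprime (r * (\<Prod>k\<in>{1..<n}. u r k)) s" by simp
      then have "gcd t s = 1" unfolding t by (simp add: gcd_diff1 coprime_imp_gcd_eq_1)
      then have "coprime t s" by (simp only: coprime_iff_gcd_eq_1)
      then show "side_ii s n q"
        using c unfolding side_ii_def prod_q by (simp flip: coprime_iff_gcd_eq_1)
    qed
  qed
qed

theorem theorem1p1:
  fixes r s :: int and n :: nat
  assumes "r > 0" and "s \<noteq> 0" and "gcd r s = 1" and "n \<ge> 2"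
  shows "finite {q. cyclic_solution r s n q \<and> side_i n q \<and> side_ii s n q} \<and>
    (\<forall>q. cyclic_solution r s n q \<and> side_i n q \<and> side_ii s n q \<longrightarrow>
       Max (q ` {1..n}) \<le>
         (if s > 0 then max (u r n - s - 1) (s\<^sup>2) else max (u r n - s - 1) \<bar>s\<bar>)) \<and>
    (u r n > s\<^sup>2 \<longrightarrow>
       (\<exists>q. cyclic_solution r s n q \<and> Max (q ` {1..n}) = u r n - s - 1 \<and>
            (\<not> (n = 2 \<and> r = 1 \<and> s = 1) \<longrightarrow> side_i n q) \<and>
            ((\<forall>i\<in>{1..<n}. coprime (u r i) s) \<longrightarrow> side_ii s n q)))"
proof (intro conjI allI impI)
  have le: "q j \<le> max (u r n - s - 1) \<bar>s\<bar>"
    if "cyclic_solution r s n q \<and> side_i n q \<and> side_ii s n q" "j \<in> {1..n}" for q j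
    using that cyclic_solution_le[OF \<open>r > 0\<close>] by blast
  have "{q. cyclic_solution r s n q \<and> side_i n q \<and> side_ii s n q} \<subseteq>
      {1..n} \<rightarrow>\<^sub>E {1..max (u r n - s - 1) \<bar>s\<bar>}"
  proof
    fix q assume "q \<in> {q. cyclic_solution r s n q \<and> side_i n q \<and> side_ii s n q}"
    then have q: "cyclic_solution r s n q \<and> side_i n q \<and> side_ii s n q" by simp
    then have "q \<in> {1..n} \<rightarrow>\<^sub>E {1..}" by (simp add: cyclic_solution_def)
    then show "q \<in> {1..n} \<rightarrow>\<^sub>E {1..max (u r n - s - 1) \<bar>s\<bar>}"
      using le[OF q] by (simp add: PiE_iff)
  qed
  then show "finite {q. cyclic_solution r s n q \<and> side_i n q \<and> side_ii s n q}"
    by (rule finite_subset) (simp add: finite_PiE)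
  fix q assume q: "cyclic_solution r s n q \<and> side_i n q \<and> side_ii s n q"
  have "Max (q ` {1..n}) \<le> max (u r n - s - 1) \<bar>s\<bar>"
    using le[OF q] \<open>n \<ge> 2\<close> by (intro Max.boundedI) auto
  \<comment> \<open>The bound with \<open>\<bar>s\<bar>\<close> holds for both signs; for
    \<open>s > 0\<close> it is weakened to \<open>s\<^sup>2\<close>.\<close>
  moreover have "\<bar>s\<bar> \<le> s\<^sup>2" using \<open>s \<noteq> 0\<close> self_le_power[of "\<bar>s\<bar>" 2] by simp
  ultimately show "Max (q ` {1..n}) \<le>
      (if s > 0 then max (u r n - s - 1) (s\<^sup>2) else max (u r n - s - 1) \<bar>s\<bar>)"
    by auto
next
  assume big: "u r n > s\<^sup>2"
  show "\<exists>q. cyclic_solution r s n q \<and> Max (q ` {1..n}) = u r n - s - 1 \<and>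
      (\<not> (n = 2 \<and> r = 1 \<and> s = 1) \<longrightarrow> side_i n q) \<and>
      ((\<forall>i\<in>{1..<n}. coprime (u r i) s) \<longrightarrow> side_ii s n q)"
  proof (cases "n = 2 \<and> r = 1 \<and> s = 1")
    case True
    \<comment> \<open>The value to attain is \<open>3 - 1 - 1 = 1\<close>, so the all-ones tuple
      serves: its congruences are modulo 1, and nothing is claimed about (i).\<close>
    have "u 1 2 = 3" using u_rec[of 1 1] u_1[of 1] by (simp add: numeral_2_eq_2)
    then show ?thesis
      using True by (intro exI[of _ "\<lambda>i\<in>{1..2}. 1"]) (auto simp: cyclic_solution_def side_ii_def)
  next
    case False
    then show ?thesis
      using u_attained[OF assms(1-4) big] by metis
  qed
qed

end
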